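(* Let $N\ge1$, $0<R\le\infty$, let $A$ and $B$ be $C^1$ functions on $(0,R)$ and let $$C(r)=(A(r)B(r))'+(N-1)\frac{A(r)B(r)}{r}-B^2(r).$$ Then for all $u\in C_0^\infty(B_R\setminus\{0\})$, $$\int_{B_R}A^2(|x|)|\mathcal{R}u|^2dx=\int_{B_R}C(|x|)|u|^2dx+\int_{B_R}\left|A(|x|)\mathcal{R}u+B(|x|)u\right|^2dx$$ and $$\int_{B_R}A^2(|x|)|\nabla u|^2dx=\int_{B_R}C(|x|)|u|^2dx+\int_{B_R}\left|A(|x|)\nabla u+B(|x|)u\frac{x}{|x|}\right|^2dx.$$
   Context: All functions are real-valued. $B_R$ is the open ball of radius $R$ centered at the origin in $\mathbb{R}^N$ ($B_\infty=\mathbb{R}^N$), and $\mathcal{R}u(x):=\frac{x}{|x|}\cdot\nabla u(x)$ is the radial derivative. *)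

theory Defs
  imports "HOL-Analysis.Analysis"
begin

(* The dimension N is DIM('a), which is at least 1 for every euclidean space.
   With R = \<infinity> this is the whole space. *)
definition origin_ball :: "ereal \<Rightarrow> 'a::euclidean_space set" where
  "origin_ball R = {x. ereal (norm x) < R}"

fun k_times_cont_diff :: "nat \<Rightarrow> ('a::euclidean_space \<Rightarrow> real) \<Rightarrow> bool" where
  "k_times_cont_diff 0 f \<longleftrightarrow> continuous_on UNIV f"
| "k_times_cont_diff (Suc k) f \<longleftrightarrow>
     f differentiable_on UNIV \<and>
     (\<forall>v. k_times_cont_diff k (\<lambda>x. frechet_derivative f (at x) v))"

definition smooth :: "('a::euclidean_space \<Rightarrow> real) \<Rightarrow> bool" where
  "smooth f \<longleftrightarrow> (\<forall>k. k_times_cont_diff k f)"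

(* For open S: a smooth function on S whose support is compact and contained in S is
   identified with its extension by zero, a smooth function on the whole space. *)
definition test_functions :: "'a::euclidean_space set \<Rightarrow> ('a \<Rightarrow> real) set" where
  "test_functions S =
     {u. smooth u \<and> compact (closure {x. u x \<noteq> 0}) \<and> closure {x. u x \<noteq> 0} \<subseteq> S}"

definition grad :: "('a::euclidean_space \<Rightarrow> real) \<Rightarrow> 'a \<Rightarrow> 'a" where
  "grad u x = (THE D. GDERIV u x :> D)"

(* x / |x|; the value at the origin is the junk value 0. *)
definition radial_dir :: "'a::euclidean_space \<Rightarrow> 'a" where
  "radial_dir x = x /\<^sub>R norm x"

definition radial_deriv :: "('a::euclidean_space \<Rightarrow> real) \<Rightarrow> 'a \<Rightarrow> real" where
  "radial_deriv u x = radial_dir x \<bullet> grad u x"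

end

(* Expanding the squares reduces both identities to the vanishing of the integral of
     C u^2 + 2 A B u Ru + B^2 u^2,
   which is the divergence of the compactly supported C^1 field A B u^2 x/|x|. That such a
   divergence integrates to 0 follows from translation invariance of Lebesgue measure by
   differentiating under the integral sign. *)

theory Submission
  imports Defs
begin

section \<open>Compactly supported functions and their divergences\<close>

lemma integrable_lborel_compact_support:
  fixes f :: "'a::euclidean_space \<Rightarrow> real"
  assumes "compact K" "continuous_on UNIV f" "\<And>x. x \<notin> K \<Longrightarrow> f x = 0"
  shows "integrable lborel f"
proof -
  have "set_integrable lborel K f"
    using assms by (meson borel_integrable_compact continuous_on_subset subset_UNIV set_integrable_def)
  moreover have "(\<lambda>x. indicator K x *\<^sub>R f x) = f"
    using assms(3) by (force simp: indicator_def)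
  ultimately show ?thesis by (simp add: set_integrable_def)
qed

text \<open>Translation invariance gives every difference quotient of \<open>f\<close> in direction
  \<open>b\<close> integral 0, and dominated convergence carries this to the limit
  \<open>f' x b\<close>. The dominating function is a constant on a large ball: the mean value
  theorem bounds the quotients, and compact support confines them.\<close>

lemma integral_directional_derivative_eq_0:
  fixes f :: "'a::euclidean_space \<Rightarrow> real"
  assumes der: "\<And>x. (f has_derivative f' x) (at x)"
    and cont: "continuous_on UNIV (\<lambda>x. f' x b)"
    and K: "compact K" and f0: "\<And>x. x \<notin> K \<Longrightarrow> f x = 0" and f'0: "\<And>x. x \<notin> K \<Longrightarrow> f' x b = 0"
  shows "integral\<^sup>L lborel (\<lambda>x. f' x b) = 0"
proof -
  have "compact ((\<lambda>x. f' x b) ` K)"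
    using K cont by (meson compact_continuous_image continuous_on_subset subset_UNIV)
  then obtain M where "0 < M" "\<forall>y\<in>(\<lambda>x. f' x b) ` K. norm y \<le> M"
    using compact_imp_bounded bounded_pos[of "(\<lambda>x. f' x b) ` K"] by blast
  then have M: "0 < M" "\<And>x. x \<in> K \<Longrightarrow> \<bar>f' x b\<bar> \<le> M"
    by auto
  \<comment> \<open>The bound is needed on the whole space, since the intermediate point of the mean
    value theorem may lie outside \<open>K\<close>.\<close>
  have Mb: "\<bar>f' x b\<bar> \<le> M" for x
    using M f'0[of x] by (cases "x \<in> K") auto
  obtain \<rho> where \<rho>: "K \<subseteq> cball 0 \<rho>"
    using compact_imp_bounded[OF K] bounded_subset_ballD[of K 0] ball_subset_cball by (meson order_trans)
  have contf: "continuous_on UNIV f"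
    using der by (meson continuous_at_imp_continuous_on has_derivative_continuous)
  have meas [measurable]: "f \<in> borel_measurable borel" "(\<lambda>x. f' x b) \<in> borel_measurable borel"
    using contf cont by (auto intro: borel_measurable_continuous_onI)
  have int: "integrable lborel f"
    by (rule integrable_lborel_compact_support[OF K contf f0])
  \<comment> \<open>The step 1/(n+1) is never 0, as the limit along \<open>at 0\<close> requires,
    and never exceeds 1, so \<open>x\<close> is displaced by at most \<open>norm b\<close>.\<close>
  define s where "s n x = (f (x + (1 / real (Suc n)) *\<^sub>R b) - f x) * real (Suc n)" for n x
  have int': "integrable lborel (\<lambda>x. f (x + c))" for c
    using integrable_distr[of "(+) c" lborel borel f] int by (simp add: lborel_distr_plus add.commute)
  have eq': "(\<integral>x. f (x + c) \<partial>lborel) = integral\<^sup>L lborel f" for c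
    using integral_distr[of "(+) c" lborel borel f] by (simp add: lborel_distr_plus add.commute)
  have s0: "integral\<^sup>L lborel (s n) = 0" for n
    unfolding s_def using int int' by (simp add: eq')
  have "(\<lambda>n. integral\<^sup>L lborel (s n)) \<longlonglongrightarrow> integral\<^sup>L lborel (\<lambda>x. f' x b)"
  proof (rule integral_dominated_convergence)
    \<comment> \<open>The radius grows by \<open>norm b\<close> because \<open>s n x\<close> can be
      nonzero at a point outside \<open>K\<close> whose translate lies in \<open>K\<close>.\<close>
    show "integrable lborel (\<lambda>x. indicator (cball 0 (\<rho> + norm b)) x * M)"
      by (intro integrable_mult_left integrable_real_indicator)
        (use emeasure_lborel_cball_finite in auto)
    show "AE x in lborel. (\<lambda>n. s n x) \<longlonglongrightarrow> f' x b"
    proof (rule AE_I2)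
      fix x
      have "((\<lambda>t. f (x + t *\<^sub>R b)) has_derivative (\<lambda>t. f' x (t *\<^sub>R b))) (at 0)"
        by (rule has_derivative_compose[where g=f and f="\<lambda>t. x + t *\<^sub>R b" and f'="\<lambda>t. t *\<^sub>R b"])
          (auto intro!: derivative_eq_intros der)
      then have "((\<lambda>t. f (x + t *\<^sub>R b)) has_real_derivative f' x b) (at 0)"
        unfolding has_field_derivative_def
        by (rule has_derivative_eq_rhs)
          (use der[of x] in \<open>auto simp: fun_eq_iff linear_cmul[OF has_derivative_linear] mult.commute\<close>)
      then have *: "((\<lambda>t. (f (x + t *\<^sub>R b) - f x) / t) \<longlongrightarrow> f' x b) (at 0)"
        by (simp add: DERIV_def)
      have "filterlim (\<lambda>n. 1 / real (Suc n)) (at 0) sequentially"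
        unfolding filterlim_at using LIMSEQ_inverse_real_of_nat
        by (auto simp: inverse_eq_divide)
      from filterlim_compose[OF * this]
      show "(\<lambda>n. s n x) \<longlonglongrightarrow> f' x b" by (simp add: s_def)
    qed
    show "AE x in lborel. norm (s n x) \<le> indicator (cball 0 (\<rho> + norm b)) x * M" for n
    proof (rule AE_I2)
      fix x
      define t where "t = 1 / real (Suc n)"
      have t: "0 < t" "t \<le> 1" "real (Suc n) = 1 / t" by (auto simp: t_def)
      show "norm (s n x) \<le> indicator (cball 0 (\<rho> + norm b)) x * M"
      proof (cases "x \<in> cball 0 (\<rho> + norm b)")
        case True
        have "((\<lambda>\<tau>. f (x + \<tau> *\<^sub>R b)) has_derivative (\<lambda>h. f' (x + \<tau> *\<^sub>R b) (h *\<^sub>R b))) (at \<tau> within {0..t})" for \<tau>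
          by (rule has_derivative_compose[where g=f and f="\<lambda>t. x + t *\<^sub>R b" and f'="\<lambda>t. t *\<^sub>R b"])
            (auto intro!: derivative_eq_intros der)
        from mvt_simple[OF t(1) this] obtain \<tau> where
          "f (x + t *\<^sub>R b) - f (x + 0 *\<^sub>R b) = f' (x + \<tau> *\<^sub>R b) ((t - 0) *\<^sub>R b)" by blast
        then have "f (x + t *\<^sub>R b) - f x = t * f' (x + \<tau> *\<^sub>R b) b"
          using linear_cmul[OF has_derivative_linear[OF der]] by simp
        then have "s n x = f' (x + \<tau> *\<^sub>R b) b"
          unfolding s_def t(3) using t(1) by simp
        then show ?thesis using True Mb by simp
      next
        case False
        have "norm x \<le> norm (x + t *\<^sub>R b) + norm (t *\<^sub>R b)"
          using norm_triangle_ineq4[of "x + t *\<^sub>R b" "t *\<^sub>R b"] by simp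
        also have "norm (t *\<^sub>R b) \<le> norm b" using t by (simp add: mult_left_le_one_le)
        finally have "x + t *\<^sub>R b \<notin> K" using False \<rho> by auto
        moreover have "x \<notin> K" using False \<rho> by (auto simp: add_increasing2 subset_iff)
        ultimately show ?thesis using False f0 by (simp add: s_def t_def)
      qed
    qed
  qed (simp_all add: s_def[abs_def])
  with s0 show ?thesis by (simp add: LIMSEQ_const_iff)
qed

text \<open>The open sets \<open>S\<close> and \<open>- K\<close> cover the space, and
  \<open>f\<close> is continuous on each, being 0 on the second. This takes care of expressions in
  \<open>norm x\<close> that are under control only on the punctured ball.\<close>

lemma continuous_on_UNIV_zero_extension:
  fixes f :: "'a::euclidean_space \<Rightarrow> 'b::real_normed_vector"
  assumes "open S" "compact K" "K \<subseteq> S" "continuous_on S f" "\<And>x. x \<notin> K \<Longrightarrow> f x = 0"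
  shows "continuous_on UNIV f"
proof -
  have "continuous_on (- K) f"
    using assms(5) continuous_on_cong[of "-K" "-K" f "\<lambda>_. 0"] by auto
  then have "continuous_on (S \<union> - K) f"
    using assms by (intro continuous_on_open_Un) (auto simp: compact_imp_closed open_Compl)
  moreover have "S \<union> - K = UNIV" using assms(3) by auto
  ultimately show ?thesis by simp
qed

text \<open>The integrand is the divergence of the field g(x) x, so its integral is a sum of
  integrals of partial derivatives. Any radial field away from the origin has this form, and only
  the scalar factor \<open>g\<close> then has to be differentiated.\<close>

lemma integral_divergence_scaled_position_eq_0:
  fixes g :: "'a::euclidean_space \<Rightarrow> real"
  assumes der: "\<And>x. (g has_derivative (\<lambda>h. h \<bullet> G x)) (at x)"
    and cont: "continuous_on UNIV G"
    and K: "compact K" and g0: "\<And>x. x \<notin> K \<Longrightarrow> g x = 0" and G0: "\<And>x. x \<notin> K \<Longrightarrow> G x = 0"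
  shows "integral\<^sup>L lborel (\<lambda>x. real DIM('a) * g x + x \<bullet> G x) = 0"
proof -
  have contg: "continuous_on UNIV g"
    using der by (meson continuous_at_imp_continuous_on has_derivative_continuous)
  \<comment> \<open>\<open>D b x\<close> is the derivative at \<open>x\<close> of the
    \<open>b\<close>-component of g(x) x. At \<open>h = b\<close> with \<open>b\<close> in
    \<open>Basis\<close> the second term is \<open>g x\<close>, and summing these terms produces the
    factor \<open>DIM('a)\<close>.\<close>
  define D where "D b x h = (x \<bullet> b) * (h \<bullet> G x) + (h \<bullet> b) * g x" for b x h
  have contD: "continuous_on UNIV (\<lambda>x. D b x b)" for b
    unfolding D_def by (intro continuous_intros cont contg)
  have D0: "D b x b = 0" if "x \<notin> K" for b x
    using that by (simp add: D_def g0 G0)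
  have "integral\<^sup>L lborel (\<lambda>x. D b x b) = 0" for b
  proof (rule integral_directional_derivative_eq_0[where f="\<lambda>x. (x \<bullet> b) * g x" and f'="D b", OF _ contD K _ D0])
    show "((\<lambda>x. (x \<bullet> b) * g x) has_derivative D b x) (at x)" for x
      unfolding D_def by (auto intro!: derivative_eq_intros der)
  qed (auto simp: g0)
  moreover have "integrable lborel (\<lambda>x. D b x b)" for b
    by (rule integrable_lborel_compact_support[OF K contD D0])
  ultimately have "integral\<^sup>L lborel (\<lambda>x. \<Sum>b\<in>Basis. D b x b) = 0"
    by (subst Bochner_Integration.integral_sum) auto
  also have "(\<lambda>x. \<Sum>b\<in>Basis. D b x b) = (\<lambda>x. real DIM('a) * g x + x \<bullet> G x)"
  proof
    fix x
    have "(\<Sum>b\<in>Basis. D b x b) = (\<Sum>b\<in>Basis. (x \<bullet> b) * (G x \<bullet> b)) + (\<Sum>b\<in>(Basis::'a set). g x)"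
      by (simp add: D_def inner_commute sum.distrib)
    then show "(\<Sum>b\<in>Basis. D b x b) = real DIM('a) * g x + x \<bullet> G x"
      by (simp add: euclidean_inner[of x "G x"])
  qed
  finally show ?thesis .
qed

text \<open>As \<open>grad\<close> is a definite description, both existence and uniqueness are
  required. The vector of the values of the derivative on \<open>Basis\<close> is a gradient, and
  uniqueness of the Frechet derivative makes it the only one.\<close>

lemma smooth_has_derivative_grad:
  assumes "smooth u"
  shows "(u has_derivative (\<lambda>h. h \<bullet> grad u x)) (at x)"
proof -
  have "k_times_cont_diff (Suc 0) u" using assms smooth_def by blast
  then have "u differentiable (at x)" by (simp add: differentiable_on_def)
  then obtain u' where u': "(u has_derivative u') (at x)" by (auto simp: differentiable_def)
  have "u' = (\<lambda>h. h \<bullet> (\<Sum>b\<in>Basis. u' b *\<^sub>R b))"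
  proof
    fix h
    have "u' h = u' (\<Sum>b\<in>Basis. (h \<bullet> b) *\<^sub>R b)" by (simp add: euclidean_representation)
    also have "\<dots> = (\<Sum>b\<in>Basis. (h \<bullet> b) * u' b)"
      using has_derivative_linear[OF u'] by (simp add: linear_sum linear_cmul)
    finally show "u' h = h \<bullet> (\<Sum>b\<in>Basis. u' b *\<^sub>R b)"
      by (simp add: inner_sum_right mult.commute)
  qed
  with u' have ex: "GDERIV u x :> (\<Sum>b\<in>Basis. u' b *\<^sub>R b)" by (simp add: gderiv_def)
  have "GDERIV u x :> grad u x"
    unfolding grad_def
  proof (rule theI[where P="\<lambda>D. GDERIV u x :> D", OF ex])
    fix D assume "GDERIV u x :> D"
    then have "(\<lambda>h. h \<bullet> D) = (\<lambda>h. h \<bullet> (\<Sum>b\<in>Basis. u' b *\<^sub>R b))"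
      using ex unfolding gderiv_def by (rule has_derivative_unique)
    then show "D = (\<Sum>b\<in>Basis. u' b *\<^sub>R b)" by (metis vector_eq_ldot)
  qed
  then show ?thesis by (simp add: gderiv_def)
qed

lemma smooth_continuous_grad:
  assumes "smooth u"
  shows "continuous_on UNIV (grad u)"
proof -
  have k: "k_times_cont_diff (Suc 0) u" using assms smooth_def by blast
  have "frechet_derivative u (at x) = (\<lambda>h. h \<bullet> grad u x)" for x
    using frechet_derivative_at[OF smooth_has_derivative_grad[OF assms]] by simp
  with k have "continuous_on UNIV (\<lambda>x. v \<bullet> grad u x)" for v by simp
  then show ?thesis
    by (subst continuous_on_componentwise) (auto simp: inner_commute)
qed

text \<open>Since the support lies in \<open>U\<close>, multiplying by the indicator of
  \<open>U\<close> changes nothing; since \<open>f\<close> is continuous, hence Borel, passing from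
  \<open>lborel\<close> to its completion \<open>lebesgue\<close> preserves integrability and the
  integral.\<close>

lemma set_integral_lebesgue_support:
  fixes f :: "'a::euclidean_space \<Rightarrow> real"
  assumes "continuous_on UNIV f" "compact K" "K \<subseteq> U" "\<And>x. x \<notin> K \<Longrightarrow> f x = 0"
  shows "set_integrable lebesgue U f"
    and "(LINT x:U|lebesgue. f x) = integral\<^sup>L lborel f"
proof -
  have eq: "(\<lambda>x. indicator U x *\<^sub>R f x) = f"
    using assms(3,4) by (fastforce simp: indicator_def)
  have i: "integrable lborel f" using assms integrable_lborel_compact_support by blast
  then show "set_integrable lebesgue U f"
    by (simp add: set_integrable_def eq[unfolded real_scaleR_def] integrable_completion)
  show "(LINT x:U|lebesgue. f x) = integral\<^sup>L lborel f"
    using i by (simp add: set_lebesgue_integral_def eq[unfolded real_scaleR_def] integral_completion)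
qed

theorem theorem2p1:
  fixes R :: ereal
    and A B C :: "real \<Rightarrow> real"
    and u :: "'a::euclidean_space \<Rightarrow> real"
  assumes R: "0 < R"
    and A: "A C1_differentiable_on einterval 0 R"
    and B: "B C1_differentiable_on einterval 0 R"
    and C: "\<And>r. r \<in> einterval 0 R \<Longrightarrow>
              C r = deriv (\<lambda>s. A s * B s) r
                    + (real DIM('a) - 1) * (A r * B r / r) - (B r)\<^sup>2"
    and u: "u \<in> test_functions (origin_ball R - {0})"
  shows
    "set_integrable lebesgue (origin_ball R) (\<lambda>x. (A (norm x))\<^sup>2 * \<bar>radial_deriv u x\<bar>\<^sup>2) \<and>
     set_integrable lebesgue (origin_ball R) (\<lambda>x. (A (norm x))\<^sup>2 * (norm (grad u x))\<^sup>2) \<and>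
     set_integrable lebesgue (origin_ball R) (\<lambda>x. C (norm x) * \<bar>u x\<bar>\<^sup>2) \<and>
     set_integrable lebesgue (origin_ball R)
       (\<lambda>x. \<bar>A (norm x) * radial_deriv u x + B (norm x) * u x\<bar>\<^sup>2) \<and>
     set_integrable lebesgue (origin_ball R)
       (\<lambda>x. (norm (A (norm x) *\<^sub>R grad u x + (B (norm x) * u x) *\<^sub>R radial_dir x))\<^sup>2) \<and>
     (LINT x:origin_ball R|lebesgue. (A (norm x))\<^sup>2 * \<bar>radial_deriv u x\<bar>\<^sup>2) =
       (LINT x:origin_ball R|lebesgue. C (norm x) * \<bar>u x\<bar>\<^sup>2) +
       (LINT x:origin_ball R|lebesgue.
          \<bar>A (norm x) * radial_deriv u x + B (norm x) * u x\<bar>\<^sup>2) \<and>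
     (LINT x:origin_ball R|lebesgue. (A (norm x))\<^sup>2 * (norm (grad u x))\<^sup>2) =
       (LINT x:origin_ball R|lebesgue. C (norm x) * \<bar>u x\<bar>\<^sup>2) +
       (LINT x:origin_ball R|lebesgue.
          (norm (A (norm x) *\<^sub>R grad u x + (B (norm x) * u x) *\<^sub>R radial_dir x))\<^sup>2)"
proof -

  \<comment> \<open>Support of \<open>u\<close> inside the punctured ball\<close>
  define K where "K = closure {x. u x \<noteq> 0}"
  define S where "S = origin_ball R - {0::'a}"
  have K: "compact K" "K \<subseteq> S" and sm: "smooth u"
    using u by (auto simp: test_functions_def K_def S_def)
  have S_iff: "x \<in> S \<longleftrightarrow> norm x \<in> einterval 0 R" for x
    by (auto simp: S_def origin_ball_def einterval_def)
  have "S = norm -` einterval 0 R" using S_iff by auto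
  then have openS: "open S" by (metis continuous_on_norm_id open_einterval open_vimage)
  have KU: "K \<subseteq> origin_ball R" using K by (auto simp: S_def)
  have openK: "open (- K)" using K by (simp add: compact_imp_closed open_Compl)
  have u0: "u x = 0" if "x \<notin> K" for x
    using that closure_subset[of "{x. u x \<noteq> 0}"] unfolding K_def by auto
  note du = smooth_has_derivative_grad[OF sm]
  note contG = continuous_on_subset[OF smooth_continuous_grad[OF sm] subset_UNIV]
  have contu: "continuous_on T u" for T
    using du by (meson continuous_at_imp_continuous_on has_derivative_continuous)
  \<comment> \<open>\<open>K\<close> is closed, so a point outside it has a whole neighbourhood on
    which \<open>u\<close> vanishes.\<close>
  have G0: "grad u x = 0" if "x \<notin> K" for x
  proof -
    have "(u has_derivative (\<lambda>h. 0)) (at x)"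
      by (rule has_derivative_transform_within_open[OF has_derivative_const[of 0] openK])
        (use that u0 in auto)
    from has_derivative_unique[OF du this] have "grad u x \<bullet> grad u x = 0" by metis
    then show ?thesis by simp
  qed
  have r0: "radial_deriv u x = 0" if "x \<notin> K" for x
    using G0[OF that] by (simp add: radial_deriv_def)

  \<comment> \<open>Regularity of the radial coefficients on (0,R)\<close>
  define p where "p r = A r * B r" for r
  define p' where "p' = deriv p"
  obtain dA dB where
    dA: "\<And>r. r \<in> einterval 0 R \<Longrightarrow> (A has_real_derivative dA r) (at r)" "continuous_on (einterval 0 R) dA" and
    dB: "\<And>r. r \<in> einterval 0 R \<Longrightarrow> (B has_real_derivative dB r) (at r)" "continuous_on (einterval 0 R) dB"
    using A B unfolding C1_differentiable_on_def has_real_derivative_iff_has_vector_derivative by blast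
  have contA: "continuous_on (einterval 0 R) A" and contB: "continuous_on (einterval 0 R) B"
    using dA dB by (meson DERIV_isCont continuous_at_imp_continuous_on)+
  have dp0: "(p has_real_derivative (dA r * B r + A r * dB r)) (at r)" if "r \<in> einterval 0 R" for r
    unfolding p_def using that by (auto intro!: derivative_eq_intros dA dB)
  then have p'_eq: "p' r = dA r * B r + A r * dB r" if "r \<in> einterval 0 R" for r
    using that by (simp add: p'_def DERIV_imp_deriv)
  have dp: "(p has_real_derivative p' r) (at r)" if "r \<in> einterval 0 R" for r
    using dp0 p'_eq that by simp
  have "continuous_on (einterval 0 R) (\<lambda>r. dA r * B r + A r * dB r)"
    by (intro continuous_intros contA contB dA dB)
  then have contp': "continuous_on (einterval 0 R) p'"
    by (rule continuous_on_eq) (simp add: p'_eq)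
  have C_eq: "C r = p' r + (real DIM('a) - 1) * (p r / r) - (B r)\<^sup>2" if "r \<in> einterval 0 R" for r
    using C[OF that] by (simp add: p'_def p_def[abs_def])
  have "continuous_on (einterval 0 R) (\<lambda>r. p' r + (real DIM('a) - 1) * (p r / r) - (B r)\<^sup>2)"
    unfolding p_def by (intro continuous_intros contA contB contp') (auto simp: einterval_def)
  \<comment> \<open>Continuity of \<open>C\<close> comes from its formula: \<open>p'\<close> is
    continuous because \<open>A\<close> and \<open>B\<close> are C^1, and r stays away from
    0.\<close>
  then have contC: "continuous_on (einterval 0 R) C"
    by (rule continuous_on_eq) (simp add: C_eq)
  have cn: "continuous_on S (\<lambda>x. q (norm x))" if "continuous_on (einterval 0 R) q" for q :: "real \<Rightarrow> real"
    by (rule continuous_on_compose2[OF that continuous_on_norm_id]) (auto simp: S_iff)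
  note cA = cn[OF contA] and cB = cn[OF contB] and cC = cn[OF contC] and cp' = cn[OF contp']
  have cp: "continuous_on S (\<lambda>x. p (norm x))"
    unfolding p_def by (intro continuous_intros cA cB)
  have cr: "continuous_on S radial_dir"
    unfolding radial_dir_def by (intro continuous_intros) (auto simp: S_def)
  have cR: "continuous_on S (radial_deriv u)"
    unfolding radial_deriv_def[abs_def] by (intro continuous_intros cr contG)
  note cs = cA cB cC cp cp' cr cR contG contu

  \<comment> \<open>The divergence of A B u^2 x/|x|\<close>
  define g where "g x = p (norm x) / norm x * (u x)\<^sup>2" for x
  \<comment> \<open>With this \<open>g\<close>, the field g(x) x equals A B u^2 x/|x| off the
    origin. \<open>dg\<close> is the gradient of \<open>g\<close> by the product rule, with (p/r)' =
    p'/r - p/r^2 and \<open>radial_dir\<close> as the gradient of the norm.\<close>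
  define dg where "dg x = ((p' (norm x) / norm x - p (norm x) / (norm x)\<^sup>2) * (u x)\<^sup>2) *\<^sub>R radial_dir x
     + (p (norm x) / norm x * (2 * u x)) *\<^sub>R grad u x" for x
  have div0: "integral\<^sup>L lborel (\<lambda>x. real DIM('a) * g x + x \<bullet> dg x) = 0"
  proof (rule integral_divergence_scaled_position_eq_0[OF _ _ K(1)])
    show "g x = 0" "dg x = 0" if "x \<notin> K" for x
      using that by (auto simp: g_def dg_def u0)
    show "continuous_on UNIV dg"
    proof (rule continuous_on_UNIV_zero_extension[OF openS K])
      show "continuous_on S dg"
        unfolding dg_def by (intro continuous_intros cs) (auto simp: S_def)
    qed (auto simp: dg_def u0)
    show "(g has_derivative (\<lambda>h. h \<bullet> dg x)) (at x)" for x
    \<comment> \<open>On \<open>K\<close> the chain rule applies because \<open>norm x\<close> lies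
      in (0,R). Off \<open>K\<close>, including at the origin and beyond the ball, \<open>g\<close>
      vanishes near \<open>x\<close>.\<close>
    proof (cases "x \<in> K")
      case True
      then have x: "x \<in> S" using K by auto
      then have nx: "x \<noteq> 0" "norm x \<in> einterval 0 R" using S_iff by (auto simp: S_def)
      have dn: "(norm has_derivative (\<lambda>h. h \<bullet> radial_dir x)) (at x)"
        using has_derivative_norm[OF nx(1)] by (simp add: radial_dir_def sgn_div_norm inner_commute)
      have q: "((\<lambda>r. p r / r) has_real_derivative (p' (norm x) / norm x - p (norm x) / (norm x)\<^sup>2)) (at (norm x))"
        using nx by (auto intro!: derivative_eq_intros dp simp: field_simps power2_eq_square)
      have du2: "((\<lambda>y. (u y)\<^sup>2) has_derivative (\<lambda>h. 2 * u x * (h \<bullet> grad u x))) (at x)"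
        by (auto intro!: derivative_eq_intros du)
      show ?thesis
        unfolding g_def
        by (rule has_derivative_eq_rhs[OF has_derivative_mult[OF
                has_derivative_compose[OF dn q[unfolded has_field_derivative_def]] du2]])
          (simp add: fun_eq_iff dg_def inner_add_right algebra_simps)
    next
      case False
      have "(g has_derivative (\<lambda>h. 0)) (at x)"
        by (rule has_derivative_transform_within_open[OF has_derivative_const[of 0] openK])
          (use False u0 in \<open>auto simp: g_def\<close>)
      then show ?thesis using False by (simp add: dg_def u0)
    qed
  qed

  \<comment> \<open>Integrability of the five integrands and the pointwise identity\<close>
  define I1 where "I1 x = (A (norm x))\<^sup>2 * \<bar>radial_deriv u x\<bar>\<^sup>2" for x
  define I2 where "I2 x = (A (norm x))\<^sup>2 * (norm (grad u x))\<^sup>2" for x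
  define I3 where "I3 x = C (norm x) * \<bar>u x\<bar>\<^sup>2" for x
  define I4 where "I4 x = \<bar>A (norm x) * radial_deriv u x + B (norm x) * u x\<bar>\<^sup>2" for x
  define I5 where "I5 x = (norm (A (norm x) *\<^sub>R grad u x + (B (norm x) * u x) *\<^sub>R radial_dir x))\<^sup>2" for x
  note I_defs = I1_def I2_def I3_def I4_def I5_def
  have z: "I1 x = 0" "I2 x = 0" "I3 x = 0" "I4 x = 0" "I5 x = 0" if "x \<notin> K" for x
    using that by (auto simp: I_defs u0 G0 r0)
  have "continuous_on S I1" "continuous_on S I2" "continuous_on S I3"
    "continuous_on S I4" "continuous_on S I5"
    unfolding I_defs by (intro continuous_intros cs)+
  note c = continuous_on_UNIV_zero_extension[OF openS K this(1) z(1)]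
    continuous_on_UNIV_zero_extension[OF openS K this(2) z(2)]
    continuous_on_UNIV_zero_extension[OF openS K this(3) z(3)]
    continuous_on_UNIV_zero_extension[OF openS K this(4) z(4)]
    continuous_on_UNIV_zero_extension[OF openS K this(5) z(5)]
  have si: "set_integrable lebesgue (origin_ball R) I1" "set_integrable lebesgue (origin_ball R) I2"
    "set_integrable lebesgue (origin_ball R) I3" "set_integrable lebesgue (origin_ball R) I4"
    "set_integrable lebesgue (origin_ball R) I5"
    using set_integral_lebesgue_support(1)[OF _ K(1) KU] c z by blast+
  have se: "(LINT x:origin_ball R|lebesgue. I1 x) = integral\<^sup>L lborel I1"
    "(LINT x:origin_ball R|lebesgue. I2 x) = integral\<^sup>L lborel I2"
    "(LINT x:origin_ball R|lebesgue. I3 x) = integral\<^sup>L lborel I3"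
    "(LINT x:origin_ball R|lebesgue. I4 x) = integral\<^sup>L lborel I4"
    "(LINT x:origin_ball R|lebesgue. I5 x) = integral\<^sup>L lborel I5"
    using set_integral_lebesgue_support(2)[OF _ K(1) KU] c z by blast+
  have ii: "integrable lborel I1" "integrable lborel I2" "integrable lborel I3"
    "integrable lborel I4" "integrable lborel I5"
    using integrable_lborel_compact_support[OF K(1)] c z by blast+
  \<comment> \<open>Both squares leave the same remainder B^2 u^2 + 2 A B u Ru, since
    \<open>radial_dir x\<close> is a unit vector whose inner product with \<open>grad u x\<close> is
    \<open>radial_deriv u x\<close>.\<close>
  have pw: "I3 x + I4 x - I1 x = real DIM('a) * g x + x \<bullet> dg x \<and>
            I3 x + I5 x - I2 x = real DIM('a) * g x + x \<bullet> dg x" for x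
  proof (cases "x \<in> K")
    case False
    then show ?thesis by (simp add: z g_def dg_def u0)
  next
    case True
    then have "x \<in> S" using K by auto
    then have nx: "norm x > 0" "norm x \<in> einterval 0 R" using S_iff by (auto simp: S_def)
    define r where "r = norm x"
    have r: "r > 0" using nx by (simp add: r_def)
    have xr: "x \<bullet> radial_dir x = r" "x \<bullet> grad u x = r * radial_deriv u x"
      using r by (auto simp: radial_deriv_def radial_dir_def r_def dot_square_norm power2_eq_square)
    have rr: "radial_dir x \<bullet> radial_dir x = 1"
      using r by (auto simp: radial_dir_def r_def dot_square_norm power2_eq_square)
    have "C r + (B r)\<^sup>2 = p' r + (real DIM('a) - 1) * (p r / r)"
      using C_eq[OF nx(2)] by (simp add: r_def)
    \<comment> \<open>The coefficient N - 1 of p/r arises as N from the multiple of \<open>g\<close>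
      minus 1 from the term -p/r^2 in \<open>dg\<close>; with p' it makes up C + B^2.\<close>
    then have "real DIM('a) * g x + x \<bullet> dg x =
        (C r + (B r)\<^sup>2) * (u x)\<^sup>2 + 2 * p r * u x * radial_deriv u x"
      using r unfolding g_def dg_def inner_add_right inner_scaleR_right xr
      by (simp only: r_def[symmetric]) (simp add: field_simps power2_eq_square)
    moreover have "I4 x - I1 x = (B r)\<^sup>2 * (u x)\<^sup>2 + 2 * p r * u x * radial_deriv u x"
      by (simp add: I_defs p_def r_def[symmetric] power2_eq_square algebra_simps)
    moreover have "I5 x - I2 x = (B r)\<^sup>2 * (u x)\<^sup>2 + 2 * p r * u x * radial_deriv u x"
      unfolding I_defs power2_norm_eq_inner inner_add_left inner_add_right inner_scaleR_left
        inner_scaleR_right rr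
      by (simp add: p_def r_def[symmetric] radial_deriv_def inner_commute[of "grad u x" "radial_dir x"]
          power2_eq_square algebra_simps)
    ultimately show ?thesis by (simp add: I3_def r_def[symmetric] algebra_simps)
  qed
  have "integral\<^sup>L lborel (\<lambda>x. I3 x + I4 x - I1 x) = 0" "integral\<^sup>L lborel (\<lambda>x. I3 x + I5 x - I2 x) = 0"
    using div0 pw by simp_all
  then have "integral\<^sup>L lborel I1 = integral\<^sup>L lborel I3 + integral\<^sup>L lborel I4"
    "integral\<^sup>L lborel I2 = integral\<^sup>L lborel I3 + integral\<^sup>L lborel I5"
    using ii by simp_all
  then show ?thesis
    using si se unfolding I_defs by simp
qed

end
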